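(* Let $g>0$, $H>0$, $U>0$, $P\ge1$, $\Delta x>0$. Let $\mathbf h(t),\mathbf u(t)\in\mathbb R^{P+1}$, $t\ge0$, be continuously differentiable solutions of the single-element semi-discrete scheme with right-boundary penalties $$\frac{d\mathbf h}{dt}+D_x(H\mathbf u+U\mathbf h)=\theta_NM_x^{-1}\mathbf e_R\mathbf e_R^\top(H\mathbf u),$$ $$\begin{aligned}\frac{d\mathbf u}{dt}&+D_x\left(g\mathbf h+U\mathbf u-\frac{H^2U}{3}D_x^2\mathbf u-\frac{H^2}{3}D_x\frac{d\mathbf u}{dt}\right)=\gamma_NM_x^{-1}D_x^\top\mathbf e_R\mathbf e_R^\top\left(H^2\frac{d\mathbf u}{dt}\right)\\&+\sigma_NM_x^{-1}\mathbf e_R\mathbf e_R^\top M_x^{-1}\mathbf e_R\mathbf e_R^\top\left(H^2\frac{d\mathbf u}{dt}\right)+\rho_NM_x^{-1}(D_x^\top)^2\mathbf e_R\mathbf e_R^\top(H^2U\mathbf u),\end{aligned}$$ with penalty parameters $\theta_N=1$, $\gamma_N=-\sigma_N=-\rho_N=\frac13$. Define $$E_{M_x}(t)=\frac g2\|\mathbf h\|^2_{M_x}+\frac H2\|\mathbf u\|^2_{M_x}+\frac{H^3}{6}\|\widetilde D_x\mathbf u\|^2_{M_x},\qquad\widetilde D_x=D_x-M_x^{-1}\mathbf e_R\mathbf e_R^\top.$$ Considering only boundary contributions from the right boundary $x=x_R$ (see context), $E_{M_x}(t)\le E_{M_x}(0)$ for all $t\ge0$.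
   Context: Operators: let $-1=\xi_1<\dots<\xi_{P+1}=1$ be the Gauss–Lobatto quadrature nodes on $[-1,1]$ with weights $\omega_i>0$ (exact for polynomials of degree $\le2P-1$), $\ell_j$ the Lagrange polynomials at these nodes, $M=\operatorname{diag}(\omega_1,\dots,\omega_{P+1})$, $Q_{ij}=\int_{-1}^1\ell_i\ell_j'\,d\xi=\sum_k\omega_k\ell_i(\xi_k)\ell_j'(\xi_k)$, $D=M^{-1}Q$, $D_x=\frac2{\Delta x}D$, $M_x=\frac{\Delta x}2M$, so that $M_xD_x+D_x^\top M_x=\operatorname{diag}(-1,0,\dots,0,1)$. The norm is $\|\mathbf u\|^2_{M_x}=\mathbf u^\top M_x\mathbf u$, and $\mathbf e_R=(0,\dots,0,1)^\top\in\mathbb R^{P+1}$. Node $1$ corresponds to the left boundary, node $P+1$ to the right boundary $x=x_R$. The scheme weakly imposes $u=0$ at $x_R$. "Considering only boundary contributions from the right boundary" means that the left-end contributions produced by summation by parts are absent, i.e. writing, entrywise, $$b=-gHhu-\frac{gU}{2}h^2-\frac{HU}{2}u^2+\frac{H^3U}{3}\left(u\,(D_x^2\mathbf u)-\frac12(D_x\mathbf u)^2\right)+\frac{H^3}{3}u\left(D_x\frac{d\mathbf u}{dt}\right),$$ it is assumed that $b_1=0$ for all $t\ge0$. *)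

theory Defs
  imports "HOL-Analysis.Analysis" "HOL-Computational_Algebra.Polynomial"
begin

text \<open>
  Vectors with one entry per node are elements of \<open>real ^ 'n\<close>, where the finite linearly ordered
  type \<open>'n\<close> (of cardinality \<open>P + 1\<close>) numbers the nodes from left to right.
\<close>

definition ixL :: "'n::{finite,linorder}" where
  "ixL = Min UNIV"

definition ixR :: "'n::{finite,linorder}" where
  "ixR = Max UNIV"

definition eR :: "real ^ 'n::{finite,linorder}" where
  "eR = axis ixR 1"

definition outer :: "real ^ 'm \<Rightarrow> real ^ 'n \<Rightarrow> real ^ 'n ^ 'm" where
  "outer v w = (\<chi> i j. v $ i * w $ j)"

definition diag_matrix :: "('n \<Rightarrow> real) \<Rightarrow> real ^ 'n ^ 'n" where
  "diag_matrix d = (\<chi> i j. if i = j then d i else 0)"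

text \<open>For \<open>P + 1\<close> points these conditions determine the nodes and the weights.\<close>

definition gauss_lobatto ::
    "nat \<Rightarrow> ('n::{finite,linorder} \<Rightarrow> real) \<Rightarrow> ('n \<Rightarrow> real) \<Rightarrow> bool" where
  "gauss_lobatto P \<xi> \<omega> \<longleftrightarrow>
     CARD('n) = P + 1 \<and> strict_mono \<xi> \<and> \<xi> ixL = -1 \<and> \<xi> ixR = 1 \<and> (\<forall>i. \<omega> i > 0) \<and>
     (\<forall>p :: real poly. degree p \<le> 2 * P - 1 \<longrightarrow>
        (\<Sum>i\<in>UNIV. \<omega> i * poly p (\<xi> i)) = integral {-1..1} (poly p))"

definition lagrange_poly :: "('n::finite \<Rightarrow> real) \<Rightarrow> 'n \<Rightarrow> real poly" where
  "lagrange_poly \<xi> j = (\<Prod>k\<in>UNIV - {j}. smult (1 / (\<xi> j - \<xi> k)) [:- \<xi> k, 1:])"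

definition Q_mat :: "('n::finite \<Rightarrow> real) \<Rightarrow> real ^ 'n ^ 'n" where
  "Q_mat \<xi> = (\<chi> i j. integral {-1..1}
     (\<lambda>x. poly (lagrange_poly \<xi> i) x * poly (pderiv (lagrange_poly \<xi> j)) x))"

definition D_mat :: "('n::finite \<Rightarrow> real) \<Rightarrow> ('n \<Rightarrow> real) \<Rightarrow> real ^ 'n ^ 'n" where
  "D_mat \<xi> \<omega> = matrix_inv (diag_matrix \<omega>) ** Q_mat \<xi>"

definition Dx_mat :: "real \<Rightarrow> ('n::finite \<Rightarrow> real) \<Rightarrow> ('n \<Rightarrow> real) \<Rightarrow> real ^ 'n ^ 'n" where
  "Dx_mat \<Delta>x \<xi> \<omega> = (2 / \<Delta>x) *\<^sub>R D_mat \<xi> \<omega>"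

definition Mx_mat :: "real \<Rightarrow> ('n::finite \<Rightarrow> real) \<Rightarrow> real ^ 'n ^ 'n" where
  "Mx_mat \<Delta>x \<omega> = (\<Delta>x / 2) *\<^sub>R diag_matrix \<omega>"

definition Dtilde_mat ::
    "real ^ 'n::{finite,linorder} ^ 'n::{finite,linorder} \<Rightarrow>
     real ^ 'n::{finite,linorder} ^ 'n::{finite,linorder} \<Rightarrow>
     real ^ 'n::{finite,linorder} ^ 'n::{finite,linorder}" where
  "Dtilde_mat Mx Dx = Dx - matrix_inv Mx ** outer eR eR"

definition sqnorm :: "real ^ 'n ^ 'n \<Rightarrow> real ^ 'n \<Rightarrow> real" where
  "sqnorm M u = u \<bullet> (M *v u)"

definition energy ::
    "real \<Rightarrow> real \<Rightarrow>
     real ^ 'n::{finite,linorder} ^ 'n::{finite,linorder} \<Rightarrow>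
     real ^ 'n::{finite,linorder} ^ 'n::{finite,linorder} \<Rightarrow>
     real ^ 'n::{finite,linorder} \<Rightarrow> real ^ 'n::{finite,linorder} \<Rightarrow> real" where
  "energy g H Mx Dx h u =
     g / 2 * sqnorm Mx h + H / 2 * sqnorm Mx u
     + H ^ 3 / 6 * sqnorm Mx (Dtilde_mat Mx Dx *v u)"

text \<open>
  The nodal quantity whose difference between the two end nodes is produced by summation by
  parts; \<open>ut\<close> is the time derivative of \<open>u\<close>.
\<close>

definition boundary_term ::
    "real \<Rightarrow> real \<Rightarrow> real \<Rightarrow> real ^ 'n ^ 'n \<Rightarrow>
     real ^ 'n \<Rightarrow> real ^ 'n \<Rightarrow> real ^ 'n \<Rightarrow> real ^ 'n" where
  "boundary_term g H U Dx h u ut = (\<chi> i.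
     - g * H * h $ i * u $ i - g * U / 2 * (h $ i)\<^sup>2 - H * U / 2 * (u $ i)\<^sup>2
     + H ^ 3 * U / 3 * (u $ i * ((Dx ** Dx) *v u) $ i - 1 / 2 * ((Dx *v u) $ i)\<^sup>2)
     + H ^ 3 / 3 * (u $ i * (Dx *v ut) $ i))"

end

theory Submission
  imports Defs
begin

text \<open>
  Energy method. Testing the two equations with \<open>g h\<close> and \<open>H u\<close> and summing by parts leaves the
  end-node difference of \<open>boundary_term\<close> and the volume term \<open>- H\<^sup>3/3 (D\<^sub>x u)\<^sup>T M\<^sub>x D\<^sub>x u'\<close>.
  The latter is cancelled by the third part of the energy up to the cross terms of the shift
  \<open>D\<^sub>x - M\<^sub>x\<^sup>-\<^sup>1 e\<^sub>R e\<^sub>R\<^sup>T\<close>, and the penalties remove exactly these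
  cross terms and all indefinite terms at the right node. What remains is
  \<open>- U/2 (g h\<^sup>2 + H u\<^sup>2 + H\<^sup>3/3 (D\<^sub>x u)\<^sup>2)\<close> at the right node. Summation by parts itself is the
  fundamental theorem of calculus applied to \<open>\<ell>\<^sub>i \<ell>\<^sub>j\<close>.
\<close>

lemma poly_lagrange_poly_node:
  fixes \<xi> :: "'n::finite \<Rightarrow> real"
  assumes "inj \<xi>"
  shows "poly (lagrange_poly \<xi> j) (\<xi> k) = (if k = j then 1 else 0)"
proof (cases "k = j")
  case True
  have "poly (lagrange_poly \<xi> j) (\<xi> j) = (\<Prod>m\<in>UNIV - {j}. 1)"
    unfolding lagrange_poly_def poly_prod
    using assms by (intro prod.cong) (auto simp: inj_eq simp flip: diff_divide_distrib add_divide_distrib)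
  then show ?thesis using True by simp
next
  case False
  then show ?thesis
    by (auto simp: lagrange_poly_def poly_prod intro!: bexI[of _ k])
qed

text \<open>By the product rule the two integrands add up to the derivative of the product of two
  basis polynomials. Since the interval ends are themselves nodes, the boundary values are Kronecker
  deltas.\<close>

lemma Q_mat_plus_transpose:
  fixes \<xi> :: "'n::{finite,linorder} \<Rightarrow> real"
  assumes "inj \<xi>" "\<xi> ixL = -1" "\<xi> ixR = 1"
  shows "Q_mat \<xi> $ i $ j + Q_mat \<xi> $ j $ i
    = (if i = ixR \<and> j = ixR then 1 else 0) - (if i = ixL \<and> j = ixL then 1 else 0)"
proof -
  let ?p = "lagrange_poly \<xi> i" and ?q = "lagrange_poly \<xi> j"
  have int: "(\<lambda>x. poly a x * poly b x) integrable_on {-1..1}" for a b :: "real poly"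
    by (intro integrable_continuous_real continuous_intros)
  have "((\<lambda>x. poly (pderiv (?p * ?q)) x) has_integral
      poly (?p * ?q) 1 - poly (?p * ?q) (-1)) {-1..1}"
    by (intro fundamental_theorem_of_calculus)
      (auto simp del: poly_mult simp flip: has_real_derivative_iff_has_vector_derivative
        intro: DERIV_subset[OF poly_DERIV])
  then have "integral {-1..1} (\<lambda>x. poly (pderiv (?p * ?q)) x)
      = poly (?p * ?q) (\<xi> ixR) - poly (?p * ?q) (\<xi> ixL)"
    using assms by (simp add: integral_unique)
  moreover have "integral {-1..1} (\<lambda>x. poly (pderiv (?p * ?q)) x)
      = Q_mat \<xi> $ i $ j + Q_mat \<xi> $ j $ i"
    by (simp add: Q_mat_def pderiv_mult integral_add int)
  ultimately show ?thesis
    by (auto simp: poly_lagrange_poly_node[OF assms(1)])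
qed

lemma diag_matrix_mult: "(diag_matrix d ** A) $ i $ j = d i * A $ i $ j"
proof -
  have "(diag_matrix d ** A) $ i $ j = (\<Sum>k\<in>UNIV. (if i = k then d i else 0) * A $ k $ j)"
    by (simp add: diag_matrix_def matrix_matrix_mult_def)
  also have "\<dots> = (\<Sum>k\<in>UNIV. if i = k then d i * A $ k $ j else 0)"
    by (intro sum.cong) auto
  finally show ?thesis
    by simp
qed

lemma Mx_mat_eq_diag_matrix: "Mx_mat \<Delta>x \<omega> = diag_matrix (\<lambda>i. \<Delta>x / 2 * \<omega> i)"
  by (auto simp: Mx_mat_def diag_matrix_def vec_eq_iff)

lemma diag_matrix_inverse:
  assumes "\<And>i. d i \<noteq> 0"
  shows "diag_matrix d ** matrix_inv (diag_matrix d) = mat 1"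
proof -
  have "diag_matrix d ** diag_matrix (\<lambda>i. 1 / d i) = mat 1"
    unfolding vec_eq_iff diag_matrix_mult using assms by (auto simp: diag_matrix_def mat_def)
  then show ?thesis
    \<comment> \<open>\<open>matrix_inv\<close> is a Hilbert choice; the reciprocal diagonal shows
      that a two-sided inverse exists to be chosen.\<close>
    unfolding matrix_inv_def
    by (intro someI2[where a = "diag_matrix (\<lambda>i. 1 / d i)" and Q = "\<lambda>B. diag_matrix d ** B = mat 1"])
      (auto simp: matrix_left_right_inverse)
qed

text \<open>The factors \<open>\<Delta>x / 2\<close> and \<open>2 / \<Delta>x\<close> cancel, so the
  element length drops out of summation by parts.\<close>

lemma Mx_mat_mult_Dx_mat:
  assumes "\<Delta>x > 0" "\<And>i. \<omega> i > 0"
  shows "Mx_mat \<Delta>x \<omega> ** Dx_mat \<Delta>x \<xi> \<omega> = Q_mat \<xi>"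
proof -
  have "Mx_mat \<Delta>x \<omega> ** Dx_mat \<Delta>x \<xi> \<omega> = diag_matrix \<omega> ** D_mat \<xi> \<omega>"
    unfolding vec_eq_iff Mx_mat_eq_diag_matrix diag_matrix_mult
    using assms(1) by (simp add: Dx_mat_def)
  also have "\<dots> = Q_mat \<xi>"
    using assms(2) by (simp add: D_mat_def matrix_mul_assoc diag_matrix_inverse less_imp_neq[symmetric])
  finally show ?thesis .
qed

lemma outer_mult_vec: "outer v w *v x = (w \<bullet> x) *\<^sub>R v"
  by (simp add: vec_eq_iff outer_def matrix_vector_mult_def inner_vec_def sum_distrib_left
      sum_distrib_right mult_ac)

lemma inner_Mx_mat_commute: "x \<bullet> (Mx_mat \<Delta>x \<omega> *v y) = (Mx_mat \<Delta>x \<omega> *v x) \<bullet> y"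
proof -
  have "transpose (Mx_mat \<Delta>x \<omega>) = Mx_mat \<Delta>x \<omega>"
    by (auto simp: transpose_def Mx_mat_def diag_matrix_def vec_eq_iff)
  then show ?thesis
    by (metis dot_lmul_matrix transpose_matrix_vector)
qed

lemma summation_by_parts:
  fixes \<omega> \<xi> :: "'n::{finite,linorder} \<Rightarrow> real" and x y :: "real ^ 'n::{finite,linorder}"
  assumes "\<Delta>x > 0" "\<And>i. \<omega> i > 0" "inj \<xi>" "\<xi> ixL = -1" "\<xi> ixR = 1"
  defines "M \<equiv> Mx_mat \<Delta>x \<omega>" and "D \<equiv> Dx_mat \<Delta>x \<xi> \<omega>"
  shows "x \<bullet> (M *v (D *v y)) + (D *v x) \<bullet> (M *v y) = x $ ixR * y $ ixR - x $ ixL * y $ ixL"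
proof -
  let ?Q = "Q_mat \<xi>"
  have Q: "M *v (D *v z) = ?Q *v z" for z
    unfolding M_def D_def matrix_vector_mul_assoc by (simp add: Mx_mat_mult_Dx_mat assms)
  have "x \<bullet> (M *v (D *v y)) + (D *v x) \<bullet> (M *v y) = x \<bullet> (?Q *v y) + y \<bullet> (?Q *v x)"
    using inner_Mx_mat_commute[of "D *v x" \<Delta>x \<omega> y]
    by (simp add: Q inner_commute flip: M_def)
  also have "y \<bullet> (?Q *v x) = x \<bullet> (transpose ?Q *v y)"
    by (metis dot_lmul_matrix inner_commute transpose_matrix_vector)
  also have "x \<bullet> (?Q *v y) + x \<bullet> (transpose ?Q *v y) = x \<bullet> ((?Q + transpose ?Q) *v y)"
    by (simp add: matrix_vector_mult_add_rdistrib inner_add_right)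
  also have "?Q + transpose ?Q = outer (axis ixR 1) (axis ixR 1) - outer (axis ixL 1) (axis ixL 1)"
    using Q_mat_plus_transpose[OF assms(3-5)]
    by (auto simp: vec_eq_iff transpose_def outer_def axis_def)
  also have "\<dots> *v y = y $ ixR *\<^sub>R axis ixR 1 - y $ ixL *\<^sub>R axis ixL 1"
    by (simp add: matrix_vector_mult_diff_rdistrib outer_mult_vec inner_axis')
  finally show ?thesis
    by (simp add: inner_diff_right inner_axis mult.commute)
qed

lemma outer_eR_mult_vec: "outer eR eR *v x = x $ ixR *\<^sub>R eR"
  by (simp add: outer_mult_vec eR_def inner_axis')

lemma inner_eR: "x \<bullet> eR = x $ ixR"
  by (simp add: eR_def inner_axis)

lemma inner_transpose_mult: "x \<bullet> (transpose A *v y) = (A *v x) \<bullet> (y :: real ^ 'n)"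
  by (metis dot_lmul_matrix inner_commute transpose_matrix_vector)

text \<open>Pure algebra at one instant: \<open>h'\<close> and \<open>u'\<close> are plain vectors,
  and of the operators only symmetry, invertibility and summation by parts enter. The left side is
  what the chain rule gives for the time derivative of \<open>energy\<close>; the constants 1/3 and
  -1/3 are the penalty parameters.\<close>

lemma energy_rate:
  fixes M D :: "real ^ 'n::{finite,linorder} ^ 'n::{finite,linorder}"
    and h u h' u' :: "real ^ 'n::{finite,linorder}"
  assumes sym: "\<And>x y. x \<bullet> (M *v y) = (M *v x) \<bullet> y"
    and inv: "M ** matrix_inv M = mat 1"
    and sbp: "\<And>x y. x \<bullet> (M *v (D *v y)) + (D *v x) \<bullet> (M *v y)
      = x $ ixR * y $ ixR - x $ ixL * y $ ixL"
    and h: "h' + D *v (H *\<^sub>R u + U *\<^sub>R h) = (matrix_inv M ** outer eR eR) *v (H *\<^sub>R u)"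
    and u: "u' + D *v (g *\<^sub>R h + U *\<^sub>R u - (H\<^sup>2 * U / 3) *\<^sub>R ((D ** D) *v u)
        - (H\<^sup>2 / 3) *\<^sub>R (D *v u'))
      = (1 / 3) *\<^sub>R ((matrix_inv M ** transpose D ** outer eR eR) *v (H\<^sup>2 *\<^sub>R u'))
        + (- (1 / 3)) *\<^sub>R ((matrix_inv M ** outer eR eR ** matrix_inv M ** outer eR eR)
            *v (H\<^sup>2 *\<^sub>R u'))
        + (- (1 / 3)) *\<^sub>R ((matrix_inv M ** (transpose D ** transpose D) ** outer eR eR)
            *v ((H\<^sup>2 * U) *\<^sub>R u))"
  defines "Dt \<equiv> Dtilde_mat M D"
  shows "g * (h \<bullet> (M *v h')) + H * (u \<bullet> (M *v u')) + H ^ 3 / 3 * ((Dt *v u) \<bullet> (M *v (Dt *v u')))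
    = - (U / 2) * (g * (h $ ixR)\<^sup>2 + H * (u $ ixR)\<^sup>2 + H ^ 3 / 3 * ((D *v u) $ ixR)\<^sup>2)
      - boundary_term g H U D h u u' $ ixL"
proof -
  define W where "W = matrix_inv M"
  \<comment> \<open>All volume terms are reduced to values of this bilinear form, the discrete
    integral of x times the derivative of y.\<close>
  define q where "q x y = x \<bullet> (M *v (D *v y))" for x y
  define w where "w = (W *v eR) $ ixR"
  have MW: "M *v (W *v x) = x" for x
    by (simp add: matrix_vector_mul_assoc W_def inv)
  note lin = matrix_vector_right_distrib matrix_vector_mult_diff_distrib matrix_vector_mult_scaleR
    inner_add_right inner_diff_right inner_scaleR_right
  have "h' = (u $ ixR * H) *\<^sub>R (W *v eR) - D *v (H *\<^sub>R u + U *\<^sub>R h)"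
    using h by (simp add: algebra_simps outer_eR_mult_vec W_def lin flip: matrix_vector_mul_assoc)
  then have hM: "h \<bullet> (M *v h') = H * u $ ixR * h $ ixR - H * q h u - U * q h h"
    by (simp add: lin MW inner_eR q_def)
  have "u' = (H\<^sup>2 / 3 * u' $ ixR) *\<^sub>R (W *v (transpose D *v eR))
      - (H\<^sup>2 / 3 * u' $ ixR * w) *\<^sub>R (W *v eR)
      - (H\<^sup>2 * U / 3 * u $ ixR) *\<^sub>R (W *v (transpose D *v (transpose D *v eR)))
      - D *v (g *\<^sub>R h + U *\<^sub>R u - (H\<^sup>2 * U / 3) *\<^sub>R (D *v (D *v u)) - (H\<^sup>2 / 3) *\<^sub>R (D *v u'))"
    using u by (simp add: eq_diff_eq outer_eR_mult_vec w_def del: transpose_matrix_vector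
        flip: matrix_vector_mul_assoc W_def)
      (simp add: lin outer_eR_mult_vec algebra_simps del: transpose_matrix_vector)
  \<comment> \<open>The scheme is implicit: \<open>u'\<close> also occurs on the right, so rewriting
    with this equation would loop. It is applied just once, by congruence.\<close>
  then have "u \<bullet> (M *v u') = u \<bullet> (M *v ((H\<^sup>2 / 3 * u' $ ixR) *\<^sub>R (W *v (transpose D *v eR))
      - (H\<^sup>2 / 3 * u' $ ixR * w) *\<^sub>R (W *v eR)
      - (H\<^sup>2 * U / 3 * u $ ixR) *\<^sub>R (W *v (transpose D *v (transpose D *v eR)))
      - D *v (g *\<^sub>R h + U *\<^sub>R u - (H\<^sup>2 * U / 3) *\<^sub>R (D *v (D *v u)) - (H\<^sup>2 / 3) *\<^sub>R (D *v u'))))"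
    by (rule arg_cong)
  then have uM: "u \<bullet> (M *v u') = H\<^sup>2 / 3 * u' $ ixR * (D *v u) $ ixR
      - H\<^sup>2 / 3 * u' $ ixR * w * u $ ixR
      - H\<^sup>2 * U / 3 * u $ ixR * (D *v (D *v u)) $ ixR
      - (g * q u h + U * q u u - H\<^sup>2 * U / 3 * q u (D *v (D *v u)) - H\<^sup>2 / 3 * q u (D *v u'))"
    by (simp only: lin MW inner_eR inner_transpose_mult q_def)
  have Dt: "Dt *v x = D *v x - x $ ixR *\<^sub>R (W *v eR)" for x
    by (simp add: Dt_def Dtilde_mat_def matrix_vector_mult_diff_rdistrib lin outer_eR_mult_vec
        flip: matrix_vector_mul_assoc W_def)
  \<comment> \<open>\<open>W *v eR\<close> represents evaluation at the right node in the
    \<open>M\<close> inner product, so the shift in \<open>Dt\<close> contributes nodal values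
    only.\<close>
  have WM: "(W *v eR) \<bullet> (M *v x) = x $ ixR" for x
    by (metis MW inner_commute inner_eR sym)
  have DtM: "(Dt *v u) \<bullet> (M *v (Dt *v u')) = (D *v u) \<bullet> (M *v (D *v u'))
      - u' $ ixR * (D *v u) $ ixR - u $ ixR * (D *v u') $ ixR + u $ ixR * u' $ ixR * w"
    by (simp add: Dt lin inner_diff_left WM MW inner_eR w_def algebra_simps)
  have Du: "(D *v u) \<bullet> (M *v (D *v u')) = u $ ixR * (D *v u') $ ixR - u $ ixL * (D *v u') $ ixL
      - q u (D *v u')"
    using sbp[of u "D *v u'"] by (simp add: q_def)
  \<comment> \<open>Two summations by parts: the first moves one derivative onto \<open>u\<close>,
    the second turns the pairing of \<open>D *v u\<close> with its own derivative into half a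
    difference of squares.\<close>
  have D2u: "q u (D *v (D *v u)) = u $ ixR * (D *v (D *v u)) $ ixR - u $ ixL * (D *v (D *v u)) $ ixL
      - ((D *v u) $ ixR)\<^sup>2 / 2 + ((D *v u) $ ixL)\<^sup>2 / 2"
    using sbp[of u "D *v (D *v u)"] sbp[of "D *v u" "D *v u"] sym[of "D *v u" "D *v (D *v u)"]
    by (simp add: q_def inner_commute power2_eq_square)
  have qd: "q x x = (x $ ixR)\<^sup>2 / 2 - (x $ ixL)\<^sup>2 / 2" for x
    using sbp[of x x] sym[of x "D *v x"] by (simp add: q_def inner_commute power2_eq_square)
  have quh: "q u h = u $ ixR * h $ ixR - u $ ixL * h $ ixL - q h u"
    using sbp[of u h] sym[of h "D *v u"] by (simp add: q_def inner_commute)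
  show ?thesis
    \<comment> \<open>Cancellations at the right node: the penalty in the \<open>h\<close> equation
      removes the product of h and u. In the \<open>u\<close> equation the first penalty removes u'
      times Du, the second the term with \<open>w\<close>, the third u times DDu. The product of u
      and Du' cancels between \<open>DtM\<close> and \<open>Du\<close>.\<close>
    unfolding hM uM DtM Du D2u qd quh
    by (simp add: boundary_term_def field_simps power2_eq_square power3_eq_cube
        flip: matrix_vector_mul_assoc)
qed

text \<open>Symmetry makes both halves of the product rule equal. The matrix \<open>A\<close> lets
  one lemma serve all three parts of the energy: the identity for \<open>h\<close> and
  \<open>u\<close>, the shifted derivative for the last.\<close>

lemma has_real_derivative_sqnorm:
  fixes M A :: "real ^ 'n ^ 'n"
  assumes sym: "\<And>x y. x \<bullet> (M *v y) = (M *v x) \<bullet> y"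
    and x: "(x has_vector_derivative x') (at t within S)"
  shows "((\<lambda>t. sqnorm M (A *v x t)) has_real_derivative 2 * ((A *v x t) \<bullet> (M *v (A *v x'))))
    (at t within S)"
proof -
  have A: "((\<lambda>t. A *v x t) has_vector_derivative A *v x') (at t within S)"
    using bounded_linear.has_vector_derivative[OF matrix_vector_mul_bounded_linear x] .
  have "((\<lambda>t. M *v (A *v x t)) has_vector_derivative M *v (A *v x')) (at t within S)"
    using bounded_linear.has_vector_derivative[OF matrix_vector_mul_bounded_linear A] .
  from bounded_bilinear.has_vector_derivative[OF bounded_bilinear_inner A this]
  show ?thesis
    using sym[of "A *v x t" "A *v x'"]
    by (simp add: sqnorm_def has_real_derivative_iff_has_vector_derivative inner_commute)
qed

theorem theorem10:
  fixes P :: nat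
    and g H U \<Delta>x \<theta>N \<gamma>N \<sigma>N \<rho>N :: real
    and \<xi> \<omega> :: "'n::{finite,linorder} \<Rightarrow> real"
    and Mx Dx :: "real ^ 'n::{finite,linorder} ^ 'n::{finite,linorder}"
    and h u h' u' :: "real \<Rightarrow> real ^ 'n::{finite,linorder}"
  assumes "g > 0" and "H > 0" and "U > 0" and "P \<ge> 1" and "\<Delta>x > 0"
    and "gauss_lobatto P \<xi> \<omega>"
    and "Mx = Mx_mat \<Delta>x \<omega>" and "Dx = Dx_mat \<Delta>x \<xi> \<omega>"
    and "\<And>t. t \<ge> 0 \<Longrightarrow> (h has_vector_derivative h' t) (at t within {0..})"
    and "\<And>t. t \<ge> 0 \<Longrightarrow> (u has_vector_derivative u' t) (at t within {0..})"
    and "continuous_on {0..} h'" and "continuous_on {0..} u'"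
    and "\<And>t. t \<ge> 0 \<Longrightarrow>
      h' t + Dx *v (H *\<^sub>R u t + U *\<^sub>R h t)
      = \<theta>N *\<^sub>R ((matrix_inv Mx ** outer eR eR) *v (H *\<^sub>R u t))"
    and "\<And>t. t \<ge> 0 \<Longrightarrow>
      u' t + Dx *v (g *\<^sub>R h t + U *\<^sub>R u t
                     - (H\<^sup>2 * U / 3) *\<^sub>R ((Dx ** Dx) *v u t)
                     - (H\<^sup>2 / 3) *\<^sub>R (Dx *v u' t))
      = \<gamma>N *\<^sub>R ((matrix_inv Mx ** transpose Dx ** outer eR eR) *v (H\<^sup>2 *\<^sub>R u' t))
        + \<sigma>N *\<^sub>R ((matrix_inv Mx ** outer eR eR ** matrix_inv Mx ** outer eR eR)
                       *v (H\<^sup>2 *\<^sub>R u' t))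
        + \<rho>N *\<^sub>R ((matrix_inv Mx ** (transpose Dx ** transpose Dx) ** outer eR eR)
                       *v ((H\<^sup>2 * U) *\<^sub>R u t))"
    and "\<theta>N = 1" and "\<gamma>N = 1 / 3" and "\<sigma>N = - (1 / 3)" and "\<rho>N = - (1 / 3)"
    and "\<And>t. t \<ge> 0 \<Longrightarrow> boundary_term g H U Dx (h t) (u t) (u' t) $ ixL = 0"
  shows "\<forall>t\<ge>0. energy g H Mx Dx (h t) (u t) \<le> energy g H Mx Dx (h 0) (u 0)"
proof (intro allI impI)
  note params = assms(1-5)
  note GL = assms(6)
  note M = assms(7)
  note D = assms(8)
  note h_deriv = assms(9)
  note u_deriv = assms(10)
  note h_eq = assms(13)
  note u_eq = assms(14)
  note penalties = assms(15-18)
  note left = assms(19)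
  fix t :: real
  assume t: "0 \<le> t"
  have \<omega>: "\<And>i. \<omega> i > 0" and \<xi>: "inj \<xi>" "\<xi> ixL = -1" "\<xi> ixR = 1"
    using GL by (auto simp: gauss_lobatto_def strict_mono_imp_inj_on)
  have sym: "x \<bullet> (Mx *v y) = (Mx *v x) \<bullet> y" for x y
    unfolding M by (rule inner_Mx_mat_commute)
  have inv: "Mx ** matrix_inv Mx = mat 1"
    unfolding M Mx_mat_eq_diag_matrix using params(5) \<omega>
    by (intro diag_matrix_inverse) (simp add: less_imp_neq[symmetric])
  have sbp: "x \<bullet> (Mx *v (Dx *v y)) + (Dx *v x) \<bullet> (Mx *v y)
      = x $ ixR * y $ ixR - x $ ixL * y $ ixL" for x y
    unfolding M D using params(5) \<omega> \<xi> by (rule summation_by_parts)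
  let ?E = "\<lambda>s. energy g H Mx Dx (h s) (u s)"
  define E' where "E' s = g * (h s \<bullet> (Mx *v h' s)) + H * (u s \<bullet> (Mx *v u' s))
    + H ^ 3 / 3 * ((Dtilde_mat Mx Dx *v u s) \<bullet> (Mx *v (Dtilde_mat Mx Dx *v u' s)))" for s
  have E_deriv: "(?E has_real_derivative E' s) (at s within {0..})" if "s \<ge> 0" for s
    unfolding energy_def E'_def
    using has_real_derivative_sqnorm[OF sym h_deriv[OF that], where A = "mat 1"]
      has_real_derivative_sqnorm[OF sym u_deriv[OF that], where A = "mat 1"]
      has_real_derivative_sqnorm[OF sym u_deriv[OF that], where A = "Dtilde_mat Mx Dx"]
    by (auto intro!: derivative_eq_intros)
  \<comment> \<open>The left-node term vanishes by assumption, leaving a negative multiple of a sum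
    of squares with positive coefficients.\<close>
  have E'_nonpos: "E' s \<le> 0" if "s \<ge> 0" for s
    unfolding E'_def
    using energy_rate[OF sym inv sbp, of "h' s" H "u s" U "h s" "u' s" g] params
      h_eq[OF that] u_eq[OF that] left[OF that]
    by (simp add: penalties)
  show "?E t \<le> ?E 0"
  \<comment> \<open>At time 0 only a one-sided derivative is given, so derivatives are taken at
    interior times and continuity covers the end points.\<close>
  proof (rule DERIV_nonpos_imp_decreasing_open[OF t])
    show "\<exists>y. (?E has_real_derivative y) (at s) \<and> y \<le> 0" if "0 < s" "s < t" for s
    proof -
      have "at s within {0..} = at s"
        using that by (intro at_within_interior) auto
      then show ?thesis
        using E_deriv[of s] E'_nonpos[of s] that by auto
    qed
    show "continuous_on {0..t} ?E"
      by (rule continuous_on_subset[OF DERIV_continuous_on[OF E_deriv]]) auto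
  qed
qed

end
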